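(* Let $(X_t)_{t\ge 1}$ be a stationary sequence of random curves $X_t=(X_t(s)\colon s\in[0,1])$ that are square integrable, with $E\int_0^1 X_t(s)^2\,ds<\infty$, mean function $\mu(s)=EX_t(s)$ and covariance kernel $\Gamma^X(s,s')=\mathrm{Cov}(X_t(s),X_t(s'))$ (not depending on $t$). Suppose that for some integer $L\geq 1$ and some orthonormal functions $b_1,\ldots,b_L$ in $L^2([0,1])$ we have $$X_t(s)=\sum_{k=1}^L\langle X_t,b_k\rangle b_k(s),\qquad s\in[0,1].$$ Let $0\leq s_1<s_2<\cdots<s_p\leq 1$ and suppose that the observations are $$Y_t=(X_t(s_1),\ldots,X_t(s_p))^\prime+U_t,\qquad U_t=(U_{t1},\ldots,U_{tp})^\prime,$$ where $U_t$ is independent of $X_t$, $EU_t=0$ and $\mathrm{Var}(U_t)$ is a diagonal matrix. Then $Y_t$ follows an $L$-factor model.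
   Context: Here $\langle a,b\rangle=\int_0^1 a(v)b(v)\,dv$, and $\mu(\boldsymbol{s})=(\mu(s_1),\ldots,\mu(s_p))^\prime$. That $Y_t$ (with noise vector $U_t$ satisfying $EU_t=0$ and $\mathrm{Var}(U_t)$ diagonal) follows an $L$-factor model means: there exist a (deterministic, not depending on $t$) matrix $B\in\mathbb{R}^{p\times L}$ and a random vector $F_t\in\mathbb{R}^L$ such that $$Y_t=\mu(\boldsymbol{s})+BF_t+U_t,\qquad EF_t=0,\quad \mathrm{Var}(F_t)=I_L,\quad \mathrm{Cov}(F_t,U_t)=0,$$ where $I_L$ is the $L\times L$ identity matrix.
   Formalization: F_t is built on an enlargement of the probability space (Y_t, U_t lifted), since e.g. X=0, U=0 on a one-point space admits no F_t with Var(F_t)=I_L; on the original space the claim is proved when the covariance of the scores ⟨X_t,b_k⟩ is invertible. *)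

theory Defs
  imports "HOL-Probability.Probability"
begin

section \<open>Functions on the unit interval\<close>

definition L2_01 :: "(real \<Rightarrow> real) set" where
  "L2_01 = {f \<in> borel_measurable (lebesgue_on {0..1}).
              integrable (lebesgue_on {0..1}) (\<lambda>v. (f v)\<^sup>2)}"

definition inner01 :: "(real \<Rightarrow> real) \<Rightarrow> (real \<Rightarrow> real) \<Rightarrow> real" where
  "inner01 a b = (LINT v|lebesgue_on {0..1}. a v * b v)"

definition orthonormal01 :: "('l \<Rightarrow> real \<Rightarrow> real) \<Rightarrow> bool" where
  "orthonormal01 b \<longleftrightarrow>
     (\<forall>k. b k \<in> L2_01) \<and> (\<forall>k l. inner01 (b k) (b l) = (if k = l then 1 else 0))"

section \<open>Moments and independence\<close>

definition covariance :: "'a measure \<Rightarrow> ('a \<Rightarrow> real) \<Rightarrow> ('a \<Rightarrow> real) \<Rightarrow> real" where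
  "covariance M f g = (LINT w|M. (f w - (LINT w'|M. f w')) * (g w - (LINT w'|M. g w')))"

definition cov_matrix ::
  "'a measure \<Rightarrow> ('a \<Rightarrow> real^'m) \<Rightarrow> ('a \<Rightarrow> real^'n) \<Rightarrow> real^'n^'m" where
  "cov_matrix M F G = (\<chi> i j. covariance M (\<lambda>w. F w $ i) (\<lambda>w. G w $ j))"

abbreviation var_matrix :: "'a measure \<Rightarrow> ('a \<Rightarrow> real^'n) \<Rightarrow> real^'n^'n" where
  "var_matrix M F \<equiv> cov_matrix M F F"

definition diagonal :: "real^'n^'n \<Rightarrow> bool" where
  "diagonal A \<longleftrightarrow> (\<forall>i j. i \<noteq> j \<longrightarrow> A $ i $ j = 0)"

text \<open>Integrals of non-integrable functions are 0 in the library, so the existence of second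
  moments is always required separately from conditions on the mean and the variance.\<close>

definition square_integrable_vec :: "'a measure \<Rightarrow> ('a \<Rightarrow> real^'n) \<Rightarrow> bool" where
  "square_integrable_vec M F \<longleftrightarrow>
     F \<in> borel_measurable M \<and> integrable M (\<lambda>w. (norm (F w))\<^sup>2)"

text \<open>The library's \<open>indep_var\<close> demands that both random elements take values in the same type.
  The following is the same notion for two different types.\<close>

definition indep_elements ::
  "'a measure \<Rightarrow> 'b measure \<Rightarrow> ('a \<Rightarrow> 'b) \<Rightarrow> 'c measure \<Rightarrow> ('a \<Rightarrow> 'c) \<Rightarrow> bool" where
  "indep_elements M S X T Y \<longleftrightarrow>
     X \<in> measurable M S \<and> Y \<in> measurable M T \<and>
     prob_space.indep_set M (sets (vimage_algebra (space M) X S))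
                            (sets (vimage_algebra (space M) Y T))"

section \<open>Random curves\<close>

definition square_integrable_curve :: "'a measure \<Rightarrow> ('a \<Rightarrow> real \<Rightarrow> real) \<Rightarrow> bool" where
  "square_integrable_curve M X \<longleftrightarrow>
     (\<lambda>(w, s). X w s) \<in> borel_measurable (M \<Otimes>\<^sub>M lebesgue_on {0..1}) \<and>
     (\<integral>\<^sup>+ w. (\<integral>\<^sup>+ s. ennreal ((X w s)\<^sup>2) \<partial>lebesgue_on {0..1}) \<partial>M) < \<infinity>"

text \<open>Second-order stationarity; for the square integrable curves considered here it is implied
  by strict stationarity. Time starts at 1.\<close>

definition stationary :: "'a measure \<Rightarrow> (nat \<Rightarrow> 'a \<Rightarrow> real \<Rightarrow> real) \<Rightarrow> bool" where
  "stationary M X \<longleftrightarrow>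
     (\<exists>m C. \<forall>t\<ge>1. \<forall>s\<in>{0..1}.
        (LINT w|M. X t w s) = m s \<and>
        (\<forall>h. \<forall>s'\<in>{0..1}. covariance M (\<lambda>w. X t w s) (\<lambda>w. X (t + h) w s') = C h s s'))"

section \<open>Factor models\<close>

text \<open>The number of factors is the cardinality of the index type \<open>'l\<close>. The loadings \<open>B\<close> do not
  depend on \<open>t\<close>, and the model equation is an almost sure identity of random vectors.

  If the scores of the curves are degenerate (say \<open>X = 0\<close>) and \<open>M\<close> carries no further randomness,
  no \<open>F t\<close> with identity variance exists on \<open>M\<close> itself. The existence of factors is
  then to be understood on an enlargement \<open>M \<Otimes>\<^sub>M K\<close>, with \<open>Y\<close> and \<open>U\<close> composed
  with \<open>fst\<close>.\<close>

definition follows_factor_model ::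
  "'l::finite itself \<Rightarrow> 'a measure \<Rightarrow> real^'p \<Rightarrow> (nat \<Rightarrow> 'a \<Rightarrow> real^'p) \<Rightarrow>
     (nat \<Rightarrow> 'a \<Rightarrow> real^'p) \<Rightarrow> bool" where
  "follows_factor_model TYPE('l) M m U Y \<longleftrightarrow>
     (\<forall>t\<ge>1. square_integrable_vec M (U t) \<and> (LINT w|M. U t w) = 0 \<and>
        diagonal (var_matrix M (U t))) \<and>
     (\<exists>(B :: real^'l^'p) (F :: nat \<Rightarrow> 'a \<Rightarrow> real^'l). \<forall>t\<ge>1.
        (AE w in M. Y t w = m + B *v F t w + U t w) \<and>
        square_integrable_vec M (F t) \<and>
        (LINT w|M. F t w) = 0 \<and>
        var_matrix M (F t) = mat 1 \<and>
        cov_matrix M (F t) (U t) = 0)"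

end

theory Submission
  imports Defs
begin

text \<open>Let \<open>\<xi>\<^sub>t\<close> be the vector of scores \<open>\<langle>X\<^sub>t, b\<^sub>k\<rangle>\<close> and \<open>A = (b\<^sub>k(s\<^sub>i))\<close>, so that
  \<open>Y\<^sub>t = A \<xi>\<^sub>t + U\<^sub>t\<close>. Since the \<open>b\<^sub>k\<close> are linearly independent on the unit interval,
  the kernel determines \<open>Var(\<xi>\<^sub>t)\<close>, which is therefore some \<open>\<Sigma>\<close> free of \<open>t\<close>, and
  \<open>Cov(X\<^sub>t(r), U\<^sub>t) = 0\<close> for all \<open>r\<close> gives \<open>Cov(\<xi>\<^sub>t, U\<^sub>t) = 0\<close>. This avoids Fubini, and it avoids the
  question whether \<open>\<xi>\<^sub>t\<close>, a path integral, is measurable for the product sigma-algebra in which the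
  independence of \<open>X\<^sub>t\<close> and \<open>U\<^sub>t\<close> is stated.

  Instead of a square root of \<open>\<Sigma>\<close> we use an invertible \<open>P\<close> for which \<open>D = P \<Sigma> P'\<close> is diagonal with
  entries 0 and 1. With \<open>Z\<^sub>t\<close> of variance \<open>I - D\<close>, uncorrelated with everything else, the factors
  \<open>F\<^sub>t = P (\<xi>\<^sub>t - E \<xi>\<^sub>t) + Z\<^sub>t\<close> have variance \<open>I\<close>, and \<open>D F\<^sub>t = P (\<xi>\<^sub>t - E \<xi>\<^sub>t)\<close> almost surely, so
  that \<open>B = A P\<^sup>-\<^sup>1 D\<close> are loadings. If \<open>\<Sigma>\<close> is invertible, then \<open>D = I\<close> and \<open>Z\<^sub>t = 0\<close>.\<close>

section \<open>Congruence of positive semidefinite matrices\<close>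

text \<open>The vector \<open>u i\<close> is left unchanged because \<open>c i = 0\<close>, so its
  multiples can be added back. This is one elimination step of a Gram-Schmidt process.\<close>

lemma span_image_diff_scaleR:
  fixes u :: "'i \<Rightarrow> 'v::real_vector"
  assumes "i \<in> I" "c i = 0"
  shows "span ((\<lambda>j. u j - c j *\<^sub>R u i) ` I) = span (u ` I)"
proof (rule span_eq[THEN iffD2], intro conjI subsetI)
  have "u j - c j *\<^sub>R u i \<in> span (u ` I)" if "j \<in> I" for j
    using that assms(1) by (intro span_diff span_scale span_base imageI)
  then show "x \<in> span (u ` I)" if "x \<in> (\<lambda>j. u j - c j *\<^sub>R u i) ` I" for x
    using that by auto
next
  let ?S = "span ((\<lambda>j. u j - c j *\<^sub>R u i) ` I)"
  have mem: "u j - c j *\<^sub>R u i \<in> ?S" if "j \<in> I" for j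
    using that by (intro span_base) auto
  then have "u i \<in> ?S" using mem[of i] assms by simp
  then have "(u j - c j *\<^sub>R u i) + c j *\<^sub>R u i \<in> ?S" if "j \<in> I" for j
    using mem[OF that] by (intro span_add span_scale)
  then show "x \<in> ?S" if "x \<in> u ` I" for x using that by auto
qed

text \<open>If \<open>h x x = 0\<close>, the form at \<open>a *\<^sub>R x + y\<close> is affine in
  \<open>a\<close> with slope \<open>2 * h x y\<close>, so it can stay nonnegative only if that
  slope vanishes. This lets Gram-Schmidt pass over null vectors of a degenerate form.\<close>

lemma psd_form_null:
  fixes h :: "'v::real_vector \<Rightarrow> 'v \<Rightarrow> real"
  assumes "bilinear h" and sym: "\<And>x y. h x y = h y x" and psd: "\<And>x. 0 \<le> h x x"
    and "h x x = 0"
  shows "h x y = 0"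
proof (rule ccontr)
  assume nz: "h x y \<noteq> 0"
  \<comment> \<open>Solves \<open>2 * a * h x y + h y y = -1\<close>.\<close>
  define a where "a = - (h y y + 1) / (2 * h x y)"
  have "h (a *\<^sub>R x + y) (a *\<^sub>R x + y) = 2 * a * h x y + h y y"
    using assms(4) sym[of y x]
    by (simp add: bilinear_ladd[OF assms(1)] bilinear_radd[OF assms(1)]
        bilinear_lmul[OF assms(1)] bilinear_rmul[OF assms(1)])
  also have "\<dots> = -1" using nz by (simp add: a_def field_simps)
  finally show False using psd[of "a *\<^sub>R x + y"] by simp
qed

text \<open>Gram-Schmidt for a possibly degenerate form, with \<open>S\<close> the set of indices
  already treated. A treated vector is orthogonal to all other members of the family, not only to
  treated ones, so that later steps leave it alone.\<close>

lemma psd_form_orthogonal_family: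
  fixes h :: "'v::real_vector \<Rightarrow> 'v \<Rightarrow> real" and v :: "'i::finite \<Rightarrow> 'v"
  assumes h: "bilinear h" and sym: "\<And>x y. h x y = h y x" and psd: "\<And>x. 0 \<le> h x x"
  shows "\<exists>u :: 'i \<Rightarrow> 'v. span (range u) = span (range v) \<and> (\<forall>i j. i \<noteq> j \<longrightarrow> h (u i) (u j) = 0)"
proof -
  have "\<exists>u :: 'i \<Rightarrow> 'v. span (range u) = span (range v) \<and> (\<forall>i\<in>S. \<forall>j. i \<noteq> j \<longrightarrow> h (u i) (u j) = 0)"
    for S :: "'i set"
    using finite[of S]
  proof induction
    case empty
    show ?case by (intro exI[of _ v]) simp
  next
    case (insert i S)
    then obtain u :: "'i \<Rightarrow> 'v" where u: "span (range u) = span (range v)"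
      and orth: "\<And>k j. k \<in> S \<Longrightarrow> k \<noteq> j \<Longrightarrow> h (u k) (u j) = 0" by metis
    \<comment> \<open>If \<open>h (u i) (u i) = 0\<close>, division by zero gives 0 and nothing is
      subtracted; \<open>psd_form_null\<close> then shows that \<open>u i\<close> is already
      orthogonal to every vector.\<close>
    define c where "c j = (if j = i then 0 else h (u j) (u i) / h (u i) (u i))" for j
    define u' where "u' j = u j - c j *\<^sub>R u i" for j
    have i: "u' i = u i" by (simp add: u'_def c_def)
    \<comment> \<open>By the induction hypothesis \<open>u k\<close> is orthogonal to
      \<open>u i\<close>, so its coefficient is 0.\<close>
    have S: "u' k = u k" if "k \<in> S" for k
      using that insert.hyps orth[of k i] by (auto simp: u'_def c_def)
    have "h (u i) (u' j) = 0" if "i \<noteq> j" for j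
      using psd_form_null[OF h sym psd, of "u i" "u j"] that sym[of "u i" "u j"]
      by (cases "h (u i) (u i) = 0")
        (auto simp: u'_def c_def bilinear_rsub[OF h] bilinear_rmul[OF h])
    moreover have "h (u k) (u' j) = 0" if "k \<in> S" "k \<noteq> j" for k j
      using that orth[of k j] orth[of k i] insert.hyps
      by (auto simp: u'_def bilinear_rsub[OF h] bilinear_rmul[OF h])
    ultimately have "\<forall>k\<in>insert i S. \<forall>j. k \<noteq> j \<longrightarrow> h (u' k) (u' j) = 0"
      using i S by auto
    moreover have "span (range u') = span (range u)"
      unfolding u'_def by (rule span_image_diff_scaleR) (auto simp: c_def)
    ultimately show ?case using u by (intro exI[of _ u']) simp
  qed
  from this[of UNIV] show ?thesis by simp
qed

text \<open>An orthogonal family is rescaled to length 1 where the form is positive. Null vectors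
  are kept with factor 1, so that the span survives; \<open>I\<close> collects the indices of the
  other vectors.\<close>

lemma psd_form_orthonormal_family:
  fixes h :: "'v::real_vector \<Rightarrow> 'v \<Rightarrow> real" and v :: "'i::finite \<Rightarrow> 'v"
  assumes h: "bilinear h" and sym: "\<And>x y. h x y = h y x" and psd: "\<And>x. 0 \<le> h x x"
  obtains u :: "'i \<Rightarrow> 'v" and I where "span (range u) = span (range v)"
    "\<And>i j. h (u i) (u j) = (if i = j \<and> i \<in> I then 1 else 0)"
proof -
  obtain w :: "'i \<Rightarrow> 'v" where w: "span (range w) = span (range v)"
    and orth: "\<And>i j. i \<noteq> j \<Longrightarrow> h (w i) (w j) = 0"
    using psd_form_orthogonal_family[OF h sym psd] by metis
  define I where "I = {i. h (w i) (w i) \<noteq> 0}"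
  define c where "c i = (if i \<in> I then 1 / sqrt (h (w i) (w i)) else 1)" for i
  define u where "u i = c i *\<^sub>R w i" for i
  have c: "c i \<noteq> 0" for i using psd[of "w i"] by (auto simp: c_def I_def)
  have "span (range u) = span (range w)"
  proof (rule span_eq[THEN iffD2], intro conjI subsetI)
    show "x \<in> span (range w)" if "x \<in> range u" for x
      using that by (auto simp: u_def intro: span_scale span_base)
    have "w i = inverse (c i) *\<^sub>R u i" for i using c by (simp add: u_def)
    then show "x \<in> span (range u)" if "x \<in> range w" for x
      using that by (metis (no_types) imageE rangeI span_base span_scale)
  qed
  moreover have "h (u i) (u j) = (if i = j \<and> i \<in> I then 1 else 0)" for i j
    using orth[of i j] psd[of "w i"]
    by (auto simp: u_def c_def I_def bilinear_lmul[OF h] bilinear_rmul[OF h] field_simps)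
  ultimately show thesis using that[of u I] w by simp
qed

text \<open>The orthogonal projection onto the coordinates in \<open>I\<close>. The projections for
  \<open>I\<close> and \<open>- I\<close> split the factor space into directions carried by the
  scores and directions to be filled with auxiliary randomness.\<close>

definition indicator_matrix :: "'n set \<Rightarrow> real^'n^'n" where
  "indicator_matrix I = (\<chi> i j. if i = j \<and> i \<in> I then 1 else 0)"

lemma transpose_indicator_matrix [simp]: "transpose (indicator_matrix I) = indicator_matrix I"
  by (auto simp: indicator_matrix_def transpose_def vec_eq_iff)

lemma indicator_matrix_mult:
  "indicator_matrix I ** indicator_matrix J = indicator_matrix (I \<inter> J :: 'n::finite set)"
proof -
  have "(\<Sum>k\<in>UNIV. (if i = k \<and> i \<in> I then 1 else 0) * (if k = j \<and> k \<in> J then 1 else 0)) =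
    (\<Sum>k\<in>UNIV. if k = i then if i = j \<and> i \<in> I \<inter> J then 1 else 0 else (0::real))" for i j
    by (rule sum.cong) auto
  then show ?thesis
    by (simp add: indicator_matrix_def matrix_matrix_mult_def vec_eq_iff)
qed

lemma indicator_matrix_empty: "indicator_matrix {} = 0"
  by (simp add: indicator_matrix_def vec_eq_iff)

lemma indicator_matrix_compl: "indicator_matrix I + indicator_matrix (- I) = mat 1"
  by (auto simp: indicator_matrix_def mat_def vec_eq_iff)

text \<open>The complementary projection annihilates this one; cancelling the invertible factor
  leaves the complementary projection equal to 0.\<close>

lemma invertible_indicator_matrix:
  assumes "invertible (indicator_matrix I :: real^'n::finite^'n)"
  shows "I = UNIV"
proof -
  obtain R where "indicator_matrix I ** R = mat 1"
    using assms unfolding invertible_def by blast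
  then have "indicator_matrix (- I) = indicator_matrix (- I) ** (indicator_matrix I ** R)"
    by simp
  also have "\<dots> = (indicator_matrix (- I) ** indicator_matrix I) ** R"
    by (rule matrix_mul_assoc)
  also have "\<dots> = 0"
    by (simp add: indicator_matrix_mult indicator_matrix_empty)
  finally have "indicator_matrix (- I) $ i $ i = (0::real)" for i :: 'n by simp
  then have "(if i \<in> - I then 1 else 0) = (0::real)" for i :: 'n
    by (simp add: indicator_matrix_def)
  then show ?thesis by (metis ComplI UNIV_eq_I zero_neq_one)
qed

text \<open>Sylvester's normal form in the semidefinite case. The standard basis is orthonormalised
  with respect to the form \<open>x \<bullet> (A *v y)\<close>, and the resulting vectors are the
  rows of \<open>P\<close>. They still span the space, so \<open>P\<close> is invertible, and the
  entries of the congruent matrix are the values of the form on these rows.\<close>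

lemma psd_matrix_congruent_indicator:
  fixes A :: "real^'n::finite^'n"
  assumes sym: "transpose A = A" and psd: "\<And>x. 0 \<le> x \<bullet> (A *v x)"
  obtains P :: "real^'n^'n" and I where "invertible P" "P ** A ** transpose P = indicator_matrix I"
proof -
  define h where "h x y = x \<bullet> (A *v y)" for x y
  have h: "bilinear h"
    by (auto simp: bilinear_def h_def linear_iff inner_add_left inner_add_right
        matrix_vector_right_distrib matrix_vector_mult_scaleR)
  have hsym: "h x y = h y x" for x y
    unfolding h_def by (metis dot_lmul_matrix inner_commute sym transpose_matrix_vector)
  obtain u :: "'n \<Rightarrow> real^'n" and I where u: "span (range u) = span (range (\<lambda>i. axis i 1))"
    "\<And>i j. h (u i) (u j) = (if i = j \<and> i \<in> I then 1 else 0)"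
    using psd_form_orthonormal_family[OF h hsym, of "\<lambda>i. axis i 1"] psd
    unfolding h_def by blast
  define P :: "real^'n^'n" where "P = (\<chi> i. u i)"
  have "range (\<lambda>i::'n. axis i (1::real)) = Basis"
    by (auto simp: Basis_vec_def)
  then have "span (range u) = UNIV" using u by simp
  moreover have "rows P = range u" by (auto simp: rows_def row_def P_def)
  ultimately have "invertible P"
    using matrix_left_invertible_span_rows[of P] by (simp add: invertible_left_inverse)
  moreover have "(P ** A ** transpose P) $ i $ j = h (u i) (u j)" for i j
  proof -
    have "(P ** A ** transpose P) $ i $ j = (\<Sum>k\<in>UNIV. (\<Sum>l\<in>UNIV. u i $ l * A $ l $ k) * u j $ k)"
      by (simp add: matrix_matrix_mult_def transpose_def P_def)
    also have "\<dots> = h (u i) (u j)"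
      by (simp add: h_def inner_vec_def matrix_vector_mult_def sum_distrib_left sum_distrib_right mult.assoc)
        (rule sum.swap)
    finally show ?thesis .
  qed
  then have "P ** A ** transpose P = indicator_matrix I"
    by (simp add: vec_eq_iff u indicator_matrix_def)
  ultimately show thesis by (rule that)
qed

section \<open>Second moments of random vectors\<close>

lemma product_integrable:
  fixes f g :: "'a \<Rightarrow> real"
  assumes [measurable]: "f \<in> borel_measurable M" "g \<in> borel_measurable M"
    and "integrable M (\<lambda>w. (f w)\<^sup>2)" "integrable M (\<lambda>w. (g w)\<^sup>2)"
  shows "integrable M (\<lambda>w. f w * g w)"
proof (rule Bochner_Integration.integrable_bound)
  show "integrable M (\<lambda>w. (f w)\<^sup>2 + (g w)\<^sup>2)"
    using assms by (intro Bochner_Integration.integrable_add)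
  have "\<bar>x * y\<bar> \<le> x\<^sup>2 + y\<^sup>2" for x y :: real
  proof -
    have "2 * \<bar>x\<bar> * \<bar>y\<bar> \<le> x\<^sup>2 + y\<^sup>2"
      using sum_squares_bound[of "\<bar>x\<bar>" "\<bar>y\<bar>"] by simp
    moreover have "0 \<le> \<bar>x\<bar> * \<bar>y\<bar>" by simp
    ultimately show ?thesis unfolding abs_mult by linarith
  qed
  then show "AE w in M. norm (f w * g w) \<le> norm ((f w)\<^sup>2 + (g w)\<^sup>2)"
    by auto
qed measurable

text \<open>The squared norm is the sum of the squared coordinates and dominates each of them. Facts
  about vectors thereby reduce to facts about real random variables.\<close>

lemma square_integrable_vec_iff:
  "square_integrable_vec M F \<longleftrightarrow>
     (\<forall>i. (\<lambda>w. F w $ i) \<in> borel_measurable M \<and> integrable M (\<lambda>w. (F w $ i)\<^sup>2))"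
proof -
  have norm: "(norm x)\<^sup>2 = (\<Sum>i\<in>UNIV. (x $ i)\<^sup>2)" for x :: "real^'n"
    by (simp add: norm_vec_def L2_set_def sum_nonneg)
  have meas: "F \<in> borel_measurable M \<longleftrightarrow> (\<forall>i. (\<lambda>w. F w $ i) \<in> borel_measurable M)"
    by (subst borel_measurable_euclidean_space) (auto simp: Basis_vec_def inner_axis)
  have "integrable M (\<lambda>w. (F w $ i)\<^sup>2)"
    if "square_integrable_vec M F" for i
  proof (rule Bochner_Integration.integrable_bound)
    show "integrable M (\<lambda>w. (norm (F w))\<^sup>2)" using that by (simp add: square_integrable_vec_def)
    show "(\<lambda>w. (F w $ i)\<^sup>2) \<in> borel_measurable M"
      using that meas by (intro borel_measurable_power) (simp add: square_integrable_vec_def)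
    have "(F w $ i)\<^sup>2 \<le> (norm (F w))\<^sup>2" for w
      using component_le_norm_cart[of "F w" i] abs_le_square_iff[of "F w $ i" "norm (F w)"] by simp
    then show "AE w in M. norm ((F w $ i)\<^sup>2) \<le> norm ((norm (F w))\<^sup>2)"
      by simp
  qed
  then show ?thesis using meas by (auto simp: square_integrable_vec_def norm)
qed

context prob_space
begin

lemma square_integrable_vecD:
  fixes F :: "'a \<Rightarrow> real^'n::finite"
  assumes "square_integrable_vec M F"
  shows "F \<in> borel_measurable M" "integrable M F" "(\<lambda>w. F w $ i) \<in> borel_measurable M"
    "integrable M (\<lambda>w. F w $ i)" "integrable M (\<lambda>w. (F w $ i)\<^sup>2)"
proof -
  show *: "F \<in> borel_measurable M" "(\<lambda>w. F w $ i) \<in> borel_measurable M"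
    "integrable M (\<lambda>w. (F w $ i)\<^sup>2)" for i
    using assms square_integrable_vec_iff[of M F] by (auto simp: square_integrable_vec_def)
  show "integrable M (\<lambda>w. F w $ i)"
    by (rule square_integrable_imp_integrable[OF *(2,3)])
  have "integrable M (\<lambda>w. norm (F w))"
    by (rule square_integrable_imp_integrable)
      (use assms in \<open>auto simp: square_integrable_vec_def intro: borel_measurable_norm\<close>)
  then show "integrable M F" using *(1) by (simp add: integrable_norm_iff)
qed

lemma integral_vec_nth:
  fixes F :: "'a \<Rightarrow> real^'n::finite"
  assumes "square_integrable_vec M F"
  shows "(LINT w|M. F w) $ i = (LINT w|M. F w $ i)"
  using integral_bounded_linear[OF bounded_linear_vec_nth square_integrable_vecD(2)[OF assms]]
  by simp

lemma square_integrable_add: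
  fixes f g :: "'a \<Rightarrow> real"
  assumes [measurable]: "f \<in> borel_measurable M" "g \<in> borel_measurable M"
    and "integrable M (\<lambda>w. (f w)\<^sup>2)" "integrable M (\<lambda>w. (g w)\<^sup>2)"
  shows "integrable M (\<lambda>w. (f w + g w)\<^sup>2)"
  using product_integrable[OF assms] assms by (simp add: power2_sum mult.assoc)

lemma square_integrable_vec_add:
  fixes F G :: "'a \<Rightarrow> real^'n::finite"
  assumes "square_integrable_vec M F" "square_integrable_vec M G"
  shows "square_integrable_vec M (\<lambda>w. F w + G w)"
  using assms by (auto simp: square_integrable_vec_iff intro!: square_integrable_add borel_measurable_add)

lemma square_integrable_vec_const: "square_integrable_vec M (\<lambda>w. c :: real^'n::finite)"
  by (simp add: square_integrable_vec_def)

lemma square_integrable_vec_diff_const: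
  fixes F :: "'a \<Rightarrow> real^'n::finite"
  assumes "square_integrable_vec M F"
  shows "square_integrable_vec M (\<lambda>w. F w - c)"
  using square_integrable_vec_add[OF assms square_integrable_vec_const[of "- c"]] by simp

lemma square_integrable_vec_mult:
  fixes F :: "'a \<Rightarrow> real^'n::finite" and A :: "real^'n^'m::finite"
  assumes "square_integrable_vec M F"
  shows "square_integrable_vec M (\<lambda>w. A *v F w)"
proof -
  have meas: "(\<lambda>w. F w $ i) \<in> borel_measurable M" for i
    using square_integrable_vecD[OF assms] by blast
  have "integrable M (\<lambda>w. (\<Sum>j\<in>S. A $ i $ j * F w $ j)\<^sup>2)" for i S
    using finite[of S]
  proof induction
    case (insert j S)
    have "integrable M (\<lambda>w. (A $ i $ j * F w $ j)\<^sup>2)"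
      using square_integrable_vecD(5)[OF assms] by (simp add: power_mult_distrib)
    moreover have "(\<lambda>w. \<Sum>j\<in>S. A $ i $ j * F w $ j) \<in> borel_measurable M"
      "(\<lambda>w. A $ i $ j * F w $ j) \<in> borel_measurable M"
      using meas by measurable
    ultimately show ?case
      using insert by (simp add: square_integrable_add)
  qed simp
  then show ?thesis
    using meas by (auto simp: square_integrable_vec_iff matrix_vector_mult_def)
qed

lemma integral_matrix_mult:
  fixes F :: "'a \<Rightarrow> real^'n::finite" and A :: "real^'n^'m::finite"
  assumes "square_integrable_vec M F"
  shows "(LINT w|M. A *v F w) = A *v (LINT w|M. F w)"
  by (rule integral_bounded_linear[OF matrix_vector_mul_bounded_linear square_integrable_vecD(2)[OF assms]])

lemma covariance_eq:
  assumes [measurable]: "f \<in> borel_measurable M" "g \<in> borel_measurable M"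
    and "integrable M (\<lambda>w. (f w)\<^sup>2)" "integrable M (\<lambda>w. (g w)\<^sup>2)"
  shows "covariance M f g = (LINT w|M. f w * g w) - (LINT w|M. f w) * (LINT w|M. g w)"
proof -
  have [simp]: "integrable M f" "integrable M g" "integrable M (\<lambda>w. f w * g w)"
    using assms product_integrable square_integrable_imp_integrable by blast+
  have "(f w - a) * (g w - b) = f w * g w - a * g w - b * f w + a * b" for w a b
    by (simp add: algebra_simps)
  then show ?thesis
    by (simp add: covariance_def prob_space)
qed

lemma covariance_cong_AE:
  assumes "AE w in M. f w = f' w" "AE w in M. g w = g' w"
    and [measurable]: "f \<in> borel_measurable M" "g \<in> borel_measurable M"
      "f' \<in> borel_measurable M" "g' \<in> borel_measurable M"
  shows "covariance M f g = covariance M f' g'"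
proof -
  have *: "(LINT w|M. f w) = (LINT w|M. f' w)" "(LINT w|M. g w) = (LINT w|M. g' w)"
    using assms by (auto intro!: integral_cong_AE)
  show ?thesis unfolding covariance_def *
    using assms(1,2) by (intro integral_cong_AE) auto
qed

lemma cov_matrix_nth:
  fixes F :: "'a \<Rightarrow> real^'n::finite" and G :: "'a \<Rightarrow> real^'m::finite"
  assumes "square_integrable_vec M F" "square_integrable_vec M G"
  shows "cov_matrix M F G $ i $ j =
    (LINT w|M. F w $ i * G w $ j) - (LINT w|M. F w $ i) * (LINT w|M. G w $ j)"
  using assms by (simp add: cov_matrix_def covariance_eq square_integrable_vecD)

lemma integrable_vec_product:
  fixes F :: "'a \<Rightarrow> real^'n::finite" and G :: "'a \<Rightarrow> real^'m::finite"
  assumes "square_integrable_vec M F" "square_integrable_vec M G"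
  shows "integrable M (\<lambda>w. F w $ i * G w $ j)"
  using assms by (intro product_integrable square_integrable_vecD)

lemma transpose_cov_matrix: "transpose (cov_matrix M F G) = cov_matrix M G F"
  by (simp add: transpose_def cov_matrix_def covariance_def mult.commute)

lemma cov_matrix_add_left:
  fixes F G :: "'a \<Rightarrow> real^'n::finite" and H :: "'a \<Rightarrow> real^'m::finite"
  assumes "square_integrable_vec M F" "square_integrable_vec M G" "square_integrable_vec M H"
  shows "cov_matrix M (\<lambda>w. F w + G w) H = cov_matrix M F H + cov_matrix M G H"
  using assms
  by (simp add: vec_eq_iff cov_matrix_nth square_integrable_vec_add square_integrable_vecD
      distrib_right integrable_vec_product)

lemma cov_matrix_mult_left:
  fixes F :: "'a \<Rightarrow> real^'n::finite" and G :: "'a \<Rightarrow> real^'m::finite" and A :: "real^'n^'k::finite"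
  assumes "square_integrable_vec M F" "square_integrable_vec M G"
  shows "cov_matrix M (\<lambda>w. A *v F w) G = A ** cov_matrix M F G"
proof (simp add: vec_eq_iff, intro allI)
  fix i j
  have *: "(LINT w|M. (\<Sum>k\<in>UNIV. A $ i $ k * F w $ k) * G w $ j)
      = (\<Sum>k\<in>UNIV. A $ i $ k * (LINT w|M. F w $ k * G w $ j))"
    using assms
    by (simp add: sum_distrib_right mult.assoc integrable_vec_product Bochner_Integration.integral_sum)
  have **: "(LINT w|M. (\<Sum>k\<in>UNIV. A $ i $ k * F w $ k))
      = (\<Sum>k\<in>UNIV. A $ i $ k * (LINT w|M. F w $ k))"
    using assms by (simp add: square_integrable_vecD Bochner_Integration.integral_sum)
  have "cov_matrix M (\<lambda>w. A *v F w) G $ i $ j =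
     (LINT w|M. (\<Sum>k\<in>UNIV. A $ i $ k * F w $ k) * G w $ j) -
     (LINT w|M. (\<Sum>k\<in>UNIV. A $ i $ k * F w $ k)) * (LINT w|M. G w $ j)"
    using assms
    by (simp add: cov_matrix_nth square_integrable_vec_mult) (simp add: matrix_vector_mult_def)
  also have "\<dots> = (A ** cov_matrix M F G) $ i $ j"
    unfolding * ** using assms
    by (simp add: matrix_matrix_mult_def cov_matrix_nth sum_distrib_right right_diff_distrib
        sum_subtractf mult.assoc)
  finally show "cov_matrix M (\<lambda>w. A *v F w) G $ i $ j = (A ** cov_matrix M F G) $ i $ j" .
qed

lemma cov_matrix_add_right:
  fixes F G :: "'a \<Rightarrow> real^'n::finite" and H :: "'a \<Rightarrow> real^'m::finite"
  assumes "square_integrable_vec M F" "square_integrable_vec M G" "square_integrable_vec M H"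
  shows "cov_matrix M H (\<lambda>w. F w + G w) = cov_matrix M H F + cov_matrix M H G"
  using assms
  by (simp add: vec_eq_iff cov_matrix_nth square_integrable_vec_add square_integrable_vecD
      distrib_left integrable_vec_product)

lemma cov_matrix_mult_right:
  fixes F :: "'a \<Rightarrow> real^'n::finite" and G :: "'a \<Rightarrow> real^'m::finite" and A :: "real^'n^'k::finite"
  assumes "square_integrable_vec M F" "square_integrable_vec M G"
  shows "cov_matrix M G (\<lambda>w. A *v F w) = cov_matrix M G F ** transpose A"
  using cov_matrix_mult_left[OF assms, of A]
  by (metis matrix_transpose_mul transpose_cov_matrix)

lemma cov_matrix_diff_const:
  fixes F :: "'a \<Rightarrow> real^'n::finite" and G :: "'a \<Rightarrow> real^'m::finite"
  assumes "square_integrable_vec M F" "square_integrable_vec M G"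
  shows "cov_matrix M (\<lambda>w. F w - c) G = cov_matrix M F G"
  and "cov_matrix M G (\<lambda>w. F w - c) = cov_matrix M G F"
  using assms by (simp_all add: cov_matrix_def covariance_def square_integrable_vecD prob_space)

text \<open>The quadratic form is the variance of the scalar random variable
  \<open>x \<bullet> F w\<close>.\<close>

lemma psd_var_matrix:
  fixes F :: "'a \<Rightarrow> real^'n::finite"
  assumes "square_integrable_vec M F"
  shows "0 \<le> x \<bullet> (var_matrix M F *v x)"
proof -
  \<comment> \<open>The vector \<open>x\<close> as a matrix with one row, so that the rules for
    covariances of matrix images apply to the scalar.\<close>
  define R :: "real^'n^1" where "R = (\<chi> i. x)"
  have "x \<bullet> (var_matrix M F *v x) = (R ** var_matrix M F ** transpose R) $ 1 $ 1"
    by (simp add: R_def inner_vec_def matrix_vector_mult_def matrix_matrix_mult_def transpose_def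
        sum_distrib_left sum_distrib_right mult.assoc)
      (rule sum.swap)
  also have "R ** var_matrix M F ** transpose R = var_matrix M (\<lambda>w. R *v F w)"
    using assms
    by (simp add: cov_matrix_mult_left cov_matrix_mult_right square_integrable_vec_mult matrix_mul_assoc)
  also have "\<dots> $ 1 $ 1 \<ge> 0"
    by (simp add: cov_matrix_def covariance_def)
  finally show ?thesis .
qed

text \<open>The diagonal entries of the variance are the integrals of the squared centred
  coordinates; when they vanish, so do these coordinates almost surely.\<close>

lemma AE_eq_mean:
  fixes F :: "'a \<Rightarrow> real^'n::finite"
  assumes F: "square_integrable_vec M F" and "var_matrix M F = 0"
  shows "AE w in M. F w = (LINT w|M. F w)"
proof -
  have "AE w in M. F w $ i = (LINT w|M. F w) $ i" for i
  proof -
    let ?G = "\<lambda>w. F w - (LINT w|M. F w)"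
    have "integrable M (\<lambda>w. (?G w $ i)\<^sup>2)"
      using square_integrable_vec_diff_const[OF F] square_integrable_vecD(5) by blast
    moreover have "(LINT w|M. (?G w $ i)\<^sup>2) = var_matrix M F $ i $ i"
      by (simp add: cov_matrix_def covariance_def power2_eq_square integral_vec_nth[OF F])
    ultimately have "AE w in M. (?G w $ i)\<^sup>2 = 0"
      using assms(2) integral_nonneg_eq_0_iff_AE[of M "\<lambda>w. (?G w $ i)\<^sup>2"] by simp
    then show ?thesis by simp
  qed
  then show ?thesis by (simp add: vec_eq_iff AE_all_countable)
qed

end

section \<open>Construction of the factors\<close>

text \<open>All the algebra, on an arbitrary probability space, so that it serves both for the
  enlarged space and for \<open>M\<close> itself with \<open>Z = 0\<close>. Since \<open>A\<close>,
  \<open>P\<close> and \<open>I\<close> do not depend on \<open>t\<close>, neither do the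
  loadings.\<close>

lemma (in prob_space) follows_factor_modelI:
  fixes \<xi> Z :: "nat \<Rightarrow> 'a \<Rightarrow> real^'l::finite" and U Y :: "nat \<Rightarrow> 'a \<Rightarrow> real^'p::finite"
    and A :: "real^'l^'p" and P :: "real^'l^'l"
  assumes P: "invertible P"
    and \<xi>: "\<And>t. t \<ge> 1 \<Longrightarrow> square_integrable_vec M (\<xi> t)"
      "\<And>t. t \<ge> 1 \<Longrightarrow> P ** var_matrix M (\<xi> t) ** transpose P = indicator_matrix I"
      "\<And>t. t \<ge> 1 \<Longrightarrow> cov_matrix M (\<xi> t) (U t) = 0"
      "\<And>t. t \<ge> 1 \<Longrightarrow> A *v (LINT w|M. \<xi> t w) = m"
    and U: "\<And>t. t \<ge> 1 \<Longrightarrow> square_integrable_vec M (U t)"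
      "\<And>t. t \<ge> 1 \<Longrightarrow> (LINT w|M. U t w) = 0"
      "\<And>t. t \<ge> 1 \<Longrightarrow> diagonal (var_matrix M (U t))"
    and Y: "\<And>t. t \<ge> 1 \<Longrightarrow> AE w in M. Y t w = A *v \<xi> t w + U t w"
    and Z: "\<And>t. t \<ge> 1 \<Longrightarrow> square_integrable_vec M (Z t)"
      "\<And>t. t \<ge> 1 \<Longrightarrow> (LINT w|M. Z t w) = 0"
      "\<And>t. t \<ge> 1 \<Longrightarrow> var_matrix M (Z t) = indicator_matrix (- I)"
      "\<And>t. t \<ge> 1 \<Longrightarrow> cov_matrix M (Z t) (\<xi> t) = 0"
      "\<And>t. t \<ge> 1 \<Longrightarrow> cov_matrix M (Z t) (U t) = 0"
  shows "follows_factor_model TYPE('l) M m U Y"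
proof -
  obtain Q where Q: "Q ** P = mat 1"
    using P unfolding invertible_def by blast
  define E where "E t = (LINT w|M. \<xi> t w)" for t
  define \<eta> where "\<eta> t w = P *v (\<xi> t w - E t)" for t w
  define F where "F t w = \<eta> t w + Z t w" for t w
  let ?D = "indicator_matrix I :: real^'l^'l" and ?D' = "indicator_matrix (- I) :: real^'l^'l"
  \<comment> \<open>Read from the right: \<open>?D\<close> removes \<open>Z\<close> from the
    factors, \<open>Q\<close> undoes \<open>P\<close>, and \<open>A\<close> maps centred scores to
    centred values of the curve at the observation points.\<close>
  let ?B = "A ** Q ** ?D"
  have "(AE w in M. Y t w = m + ?B *v F t w + U t w) \<and>
      square_integrable_vec M (F t) \<and> (LINT w|M. F t w) = 0 \<and>
      var_matrix M (F t) = mat 1 \<and> cov_matrix M (F t) (U t) = 0" if t: "t \<ge> 1" for t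
  proof -
    note \<xi> = \<xi>[OF t] and U = U[OF t] and Z = Z[OF t] and Y = Y[OF t]
    have c: "square_integrable_vec M (\<lambda>w. \<xi> t w - E t)"
      by (rule square_integrable_vec_diff_const[OF \<xi>(1)])
    have \<eta>: "square_integrable_vec M (\<eta> t)"
      unfolding \<eta>_def by (rule square_integrable_vec_mult[OF c])
    have F: "square_integrable_vec M (F t)"
      unfolding F_def by (rule square_integrable_vec_add[OF \<eta> Z(1)])
    have "(LINT w|M. \<xi> t w - E t) = 0"
      using square_integrable_vecD(2)[OF \<xi>(1)] by (simp add: E_def prob_space)
    then have E\<eta>: "(LINT w|M. \<eta> t w) = 0"
      unfolding \<eta>_def by (simp add: integral_matrix_mult[OF c])
    have EF: "(LINT w|M. F t w) = 0"
      unfolding F_def using E\<eta> Z(2) square_integrable_vecD(2)[OF \<eta>] square_integrable_vecD(2)[OF Z(1)]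
      by simp
    have cov\<eta>: "cov_matrix M (\<eta> t) G = P ** cov_matrix M (\<xi> t) G"
      if "square_integrable_vec M G" for G :: "'a \<Rightarrow> real^'k::finite"
      unfolding \<eta>_def
      by (simp add: cov_matrix_mult_left[OF c that] cov_matrix_diff_const[OF \<xi>(1) that])
    have cov\<eta>': "cov_matrix M G (\<eta> t) = cov_matrix M G (\<xi> t) ** transpose P"
      if "square_integrable_vec M G" for G :: "'a \<Rightarrow> real^'k::finite"
      unfolding \<eta>_def
      by (simp add: cov_matrix_mult_right[OF c that] cov_matrix_diff_const[OF \<xi>(1) that])
    have var\<eta>: "var_matrix M (\<eta> t) = ?D"
      using cov\<eta>[OF \<eta>] cov\<eta>'[OF \<xi>(1)] \<xi>(2) by (simp add: matrix_mul_assoc)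
    have Z\<eta>: "cov_matrix M (Z t) (\<eta> t) = 0"
      using cov\<eta>'[OF Z(1)] Z(4) by simp
    then have \<eta>Z: "cov_matrix M (\<eta> t) (Z t) = 0"
      by (subst transpose_cov_matrix[symmetric]) (simp add: transpose_def vec_eq_iff)
    have varF: "var_matrix M (F t) = mat 1"
      unfolding F_def
      by (simp add: cov_matrix_add_left[OF \<eta> Z(1) square_integrable_vec_add[OF \<eta> Z(1)]]
          cov_matrix_add_right[OF \<eta> Z(1) \<eta>] cov_matrix_add_right[OF \<eta> Z(1) Z(1)]
          var\<eta> Z(3) Z\<eta> \<eta>Z indicator_matrix_compl)
    have covFU: "cov_matrix M (F t) (U t) = 0"
      unfolding F_def
      by (simp add: cov_matrix_add_left[OF \<eta> Z(1) U(1)] cov\<eta>[OF U(1)] \<xi>(3) Z(5))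
    \<comment> \<open>A centred vector whose variance is the projection for \<open>- J\<close> has
      no component in the coordinates of \<open>J\<close>, because that component has variance 0.
      Applied to \<open>\<eta> t\<close> with \<open>- I\<close> and to \<open>Z t\<close> with
      \<open>I\<close>.\<close>
    have null: "AE w in M. indicator_matrix J *v G w = 0"
      if G: "square_integrable_vec M G" "(LINT w|M. G w) = 0"
        "var_matrix M G = indicator_matrix (- J)" for J and G :: "'a \<Rightarrow> real^'l"
    proof -
      have "var_matrix M (\<lambda>w. indicator_matrix J *v G w) = 0"
        by (simp add: cov_matrix_mult_left[OF G(1) square_integrable_vec_mult[OF G(1)]]
            cov_matrix_mult_right[OF G(1) G(1)] G(3) indicator_matrix_mult indicator_matrix_empty)
      from AE_eq_mean[OF square_integrable_vec_mult[OF G(1)] this]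
      show ?thesis by (simp add: integral_matrix_mult[OF G(1)] G(2))
    qed
    have "AE w in M. ?D' *v \<eta> t w = 0"
      by (rule null[OF \<eta> E\<eta>]) (simp add: var\<eta>)
    moreover have "AE w in M. ?D *v Z t w = 0"
      by (rule null[OF Z(1,2,3)])
    ultimately have "AE w in M. Y t w = m + ?B *v F t w + U t w"
      using Y
    proof eventually_elim
      case (elim w)
      \<comment> \<open>With \<open>?D'\<close> killing \<open>\<eta> t w\<close> and
        \<open>?D\<close> killing \<open>Z t w\<close>, the projection \<open>?D\<close> recovers
        \<open>\<eta> t w\<close> from the sum \<open>F t w\<close>.\<close>
      have "\<eta> t w = (?D + ?D') *v \<eta> t w"
        by (simp add: indicator_matrix_compl)
      then have "?D *v F t w = \<eta> t w"
        using elim by (simp add: F_def matrix_vector_right_distrib matrix_vector_mult_add_rdistrib)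
      then have "?B *v F t w = A *v (Q *v \<eta> t w)"
        by (simp flip: matrix_vector_mul_assoc)
      also have "Q *v \<eta> t w = \<xi> t w - E t"
        by (simp add: \<eta>_def matrix_vector_mul_assoc Q)
      also have "A *v \<dots> = A *v \<xi> t w - m"
        using \<xi>(4) by (simp add: matrix_vector_mult_diff_distrib E_def)
      finally show ?case using elim by simp
    qed
    then show ?thesis using F EF varF covFU by simp
  qed
  then show ?thesis
    unfolding follows_factor_model_def using U by blast
qed

section \<open>Product spaces: transfer of moments along projections, and an auxiliary random
  vector\<close>

lemma (in prob_space) distr_pair_snd:
  assumes "sigma_finite_measure N"
  shows "distr (M \<Otimes>\<^sub>M N) N snd = N"
proof (intro measure_eqI)
  fix A assume A: "A \<in> sets (distr (M \<Otimes>\<^sub>M N) N snd)"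
  then have "emeasure (distr (M \<Otimes>\<^sub>M N) N snd) A = emeasure (M \<Otimes>\<^sub>M N) (space M \<times> A)"
    by (auto simp add: emeasure_distr space_pair_measure dest: sets.sets_into_space
        intro!: arg_cong2[where f=emeasure])
  with A show "emeasure (distr (M \<Otimes>\<^sub>M N) N snd) A = emeasure N A"
    by (simp add: sigma_finite_measure.emeasure_pair_measure_Times[OF assms] emeasure_space_1)
qed simp

context
  fixes N :: "'b measure" and M :: "'a measure" and \<phi> :: "'b \<Rightarrow> 'a"
  assumes \<phi>: "\<phi> \<in> measurable N M" and distr: "distr N M \<phi> = M"
begin

lemma integral_measure_preserving:
  fixes f :: "'a \<Rightarrow> 'c::{banach, second_countable_topology}"
  assumes "f \<in> borel_measurable M"
  shows "(LINT w|N. f (\<phi> w)) = (LINT w|M. f w)"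
  using integral_distr[OF \<phi> assms] by (simp add: distr)

lemma square_integrable_vec_measure_preserving:
  assumes "square_integrable_vec M F"
  shows "square_integrable_vec N (\<lambda>w. F (\<phi> w))"
proof -
  have [measurable]: "F \<in> borel_measurable M" "\<phi> \<in> measurable N M"
    using assms \<phi> by (auto simp: square_integrable_vec_def)
  have "integrable (distr N M \<phi>) (\<lambda>w. (norm (F w))\<^sup>2)"
    using assms by (simp add: distr square_integrable_vec_def)
  then show ?thesis
    by (simp add: square_integrable_vec_def integrable_distr_eq)
qed

lemma cov_matrix_measure_preserving:
  assumes "square_integrable_vec M F" "square_integrable_vec M G"
  shows "cov_matrix N (\<lambda>w. F (\<phi> w)) (\<lambda>w. G (\<phi> w)) = cov_matrix M F G"
proof -
  have [measurable]: "(\<lambda>w. F w $ i) \<in> borel_measurable M" "(\<lambda>w. G w $ j) \<in> borel_measurable M" for i j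
    using assms by (simp_all add: square_integrable_vec_iff)
  have *: "(LINT w|N. F (\<phi> w) $ i) = (LINT w|M. F w $ i)"
    "(LINT w|N. G (\<phi> w) $ j) = (LINT w|M. G w $ j)" for i j
    by (rule integral_measure_preserving, measurable)+
  have "(LINT w|N. (F (\<phi> w) $ i - a) * (G (\<phi> w) $ j - b)) = (LINT w|M. (F w $ i - a) * (G w $ j - b))"
    for i j a b
    by (rule integral_measure_preserving) measurable
  then show ?thesis
    by (simp add: cov_matrix_def covariance_def *)
qed

lemma AE_measure_preserving: "AE w in M. P w \<Longrightarrow> AE w in N. P (\<phi> w)"
  by (rule AE_distrD[OF \<phi>, unfolded distr])

end

text \<open>By Fubini the mean of the product of coordinates is an iterated integral that factors
  into the two means. Hence randomness on the second factor is uncorrelated with all scores and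
  noise living on the first.\<close>

lemma cov_matrix_pair_eq_0:
  fixes F :: "'a \<Rightarrow> real^'n::finite" and G :: "'b \<Rightarrow> real^'m::finite"
  assumes "prob_space M" "prob_space K"
    and F: "square_integrable_vec M F" and G: "square_integrable_vec K G"
  shows "cov_matrix (M \<Otimes>\<^sub>M K) (\<lambda>w. G (snd w)) (\<lambda>w. F (fst w)) = 0"
proof -
  interpret pair_prob_space M K
    using assms by (simp add: pair_prob_space_def pair_sigma_finite_def prob_space_imp_sigma_finite)
  have fst: "fst \<in> measurable (M \<Otimes>\<^sub>M K) M" "distr (M \<Otimes>\<^sub>M K) M fst = M"
    by (simp_all add: M2.distr_pair_fst)
  have snd: "snd \<in> measurable (M \<Otimes>\<^sub>M K) K" "distr (M \<Otimes>\<^sub>M K) K snd = K"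
    by (simp_all add: M1.distr_pair_snd M2.sigma_finite_measure_axioms)
  note F' = square_integrable_vec_measure_preserving[OF fst F]
  note G' = square_integrable_vec_measure_preserving[OF snd G]
  have "cov_matrix (M \<Otimes>\<^sub>M K) (\<lambda>w. G (snd w)) (\<lambda>w. F (fst w)) $ i $ j = 0" for i j
  proof -
    have *: "(LINT w|(M \<Otimes>\<^sub>M K). F (fst w) $ j) = (LINT w|M. F w $ j)"
      "(LINT w|(M \<Otimes>\<^sub>M K). G (snd w) $ i) = (LINT w|K. G w $ i)"
      using integral_measure_preserving[OF fst M1.square_integrable_vecD(3)[OF F]]
        integral_measure_preserving[OF snd M2.square_integrable_vecD(3)[OF G]] .
    have "(LINT w|(M \<Otimes>\<^sub>M K). G (snd w) $ i * F (fst w) $ j)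
        = (LINT x|M. LINT y|K. G y $ i * F x $ j)"
      using integral_fst'[OF P.integrable_vec_product[OF G' F']] by simp
    then show ?thesis
      by (simp add: P.cov_matrix_nth[OF G' F'] *)
  qed
  then show ?thesis by (simp add: vec_eq_iff)
qed

text \<open>Take a uniformly random axis and a random sign, and scale the signed unit vector by the
  square root of the dimension. The signs cancel in the mean; each axis has probability one over the
  dimension, which the scaling compensates in the second moments.\<close>

lemma exists_standardized_vector:
  "\<exists>(K :: real measure) (Z :: real \<Rightarrow> real^'l::finite). prob_space K \<and> square_integrable_vec K Z \<and>
     (LINT w|K. Z w) = 0 \<and> var_matrix K Z = mat 1"
proof -
  \<comment> \<open>Encodes the finitely many outcomes as reals, so that \<open>K\<close> is a
    measure on a type independent of \<open>'l\<close>.\<close>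
  define g :: "'l \<times> bool \<Rightarrow> real" where "g = real \<circ> to_nat"
  define z :: "'l \<times> bool \<Rightarrow> real^'l" where
    "z = (\<lambda>(k, b). (if b then 1 else -1) *\<^sub>R sqrt CARD('l) *\<^sub>R axis k 1)"
  define K where "K = map_pmf g (pmf_of_set UNIV)"
  define Z where "Z r = z (inv g r)" for r
  have "inj g" by (simp add: g_def inj_compose inj_of_nat)
  then have Zg: "Z (g x) = z x" for x by (simp add: Z_def)
  have "finite (set_pmf K)" by (simp add: K_def)
  then have int: "integrable (measure_pmf K) f" for f :: "real \<Rightarrow> real"
    by (rule integrable_measure_pmf_finite)
  \<comment> \<open>Every moment is an average over the outcomes, with the two signs of each axis
    grouped together.\<close>
  have sum: "(LINT w|measure_pmf K. f (Z w)) = (\<Sum>k\<in>UNIV. f (z (k, True)) + f (z (k, False))) / (2 * CARD('l))"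
    for f :: "real^'l \<Rightarrow> real"
  proof -
    have "(LINT w|measure_pmf K. f (Z w)) = (\<Sum>x\<in>UNIV. f (z x)) / CARD('l \<times> bool)"
      by (simp add: K_def Zg integral_pmf_of_set)
    also have "(\<Sum>x\<in>UNIV. f (z x)) = (\<Sum>k\<in>UNIV. \<Sum>b\<in>UNIV. f (z (k, b)))"
      by (simp add: sum.cartesian_product)
    finally show ?thesis by (simp add: UNIV_bool add.commute)
  qed
  have sq: "square_integrable_vec (measure_pmf K) Z"
    by (simp add: square_integrable_vec_def int)
  have mean: "(LINT w|measure_pmf K. Z w $ i) = 0" for i
    using sum[of "\<lambda>x. x $ i"] by (simp add: z_def)
  have "var_matrix (measure_pmf K) Z $ i $ j = mat 1 $ i $ j" for i j
  proof -
    have "(\<Sum>k\<in>UNIV. axis k (1::real) $ i * axis k (1::real) $ j) = (if i = j then 1 else (0::real))"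
    proof -
      have "(\<Sum>k\<in>UNIV. axis k (1::real) $ i * axis k (1::real) $ j)
          = (\<Sum>k\<in>UNIV. if k = i then if i = j then 1 else 0 else (0::real))"
        by (rule sum.cong) (auto simp: axis_def)
      then show ?thesis by simp
    qed
    moreover have "(\<Sum>k\<in>UNIV. 2 * (real CARD('l) * (axis k (1::real) $ i * axis k (1::real) $ j)))
      = 2 * (real CARD('l) * (\<Sum>k\<in>UNIV. axis k (1::real) $ i * axis k (1::real) $ j))"
      by (simp add: sum_distrib_left)
    moreover have sqrt: "sqrt CARD('l) * (sqrt CARD('l) * x) = CARD('l) * x" for x :: real
      by (simp flip: mult.assoc)
    have "var_matrix (measure_pmf K) Z $ i $ j =
       (\<Sum>k\<in>UNIV. 2 * (real CARD('l) * (axis k 1 $ i * axis k 1 $ j))) / (2 * CARD('l))"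
      using sum[of "\<lambda>x. x $ i * x $ j"]
      by (simp add: cov_matrix_def covariance_def mean z_def sqrt mult.assoc mult.left_commute)
    ultimately show ?thesis by (simp add: mat_def)
  qed
  then have "var_matrix (measure_pmf K) Z = mat 1" by (simp add: vec_eq_iff)
  moreover have "(LINT w|measure_pmf K. Z w) = 0"
    using measure_pmf.integral_vec_nth[OF sq] mean by (simp add: vec_eq_iff)
  ultimately show ?thesis
    using sq measure_pmf.prob_space_axioms by blast
qed

section \<open>Scores of a random curve\<close>

text \<open>Multiply by \<open>b l\<close> and integrate. This converts identities valid at all
  points of the unit interval into identities between coefficients.\<close>

lemma orthonormal01_coefficients:
  fixes b :: "'l::finite \<Rightarrow> real \<Rightarrow> real"
  assumes b: "orthonormal01 b" and zero: "\<And>r. r \<in> {0..1} \<Longrightarrow> (\<Sum>k\<in>UNIV. c k * b k r) = 0"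
  shows "c l = 0"
proof -
  have int: "integrable (lebesgue_on {0..1}) (\<lambda>v. b k v * b l v)" for k
    using b by (intro product_integrable) (auto simp: orthonormal01_def L2_01_def)
  have "0 = (LINT v|lebesgue_on {0..1::real}. (0::real))"
    by simp
  also have "\<dots> = (LINT v|lebesgue_on {0..1}. (\<Sum>k\<in>UNIV. c k * b k v) * b l v)"
    using zero by (intro Bochner_Integration.integral_cong) auto
  also have "\<dots> = (\<Sum>k\<in>UNIV. c k * inner01 (b k) (b l))"
    by (simp add: sum_distrib_right mult.assoc int inner01_def Bochner_Integration.integral_sum)
  also have "\<dots> = (\<Sum>k\<in>UNIV. if k = l then c k else 0)"
    using b by (intro sum.cong) (auto simp: orthonormal01_def)
  finally show ?thesis by simp
qed

text \<open>Cauchy-Schwarz against a function of norm 1, stated in extended reals so that it covers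
  every measurable path, including those of infinite norm.\<close>

lemma inner01_power2_le:
  assumes [measurable]: "f \<in> borel_measurable (lebesgue_on {0..1})" and g: "g \<in> L2_01" "inner01 g g = 1"
  shows "ennreal ((inner01 f g)\<^sup>2) \<le> (\<integral>\<^sup>+ v. ennreal ((f v)\<^sup>2) \<partial>lebesgue_on {0..1})"
proof (cases "integrable (lebesgue_on {0..1}) (\<lambda>v. f v * g v)")
  case True
  let ?L = "lebesgue_on {0..1::real}"
  have [measurable]: "g \<in> borel_measurable ?L" using g by (simp add: L2_01_def)
  have "ennreal ((inner01 f g)\<^sup>2) = (ennreal \<bar>inner01 f g\<bar>)\<^sup>2"
    by (simp add: ennreal_power)
  also have "\<dots> \<le> (\<integral>\<^sup>+ v. ennreal \<bar>f v\<bar> * ennreal \<bar>g v\<bar> \<partial>?L)\<^sup>2"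
    using integral_norm_bound_ennreal[OF True]
    by (intro power_mono) (simp_all add: inner01_def abs_mult ennreal_mult)
  also have "\<dots> \<le> (\<integral>\<^sup>+ v. ennreal \<bar>f v\<bar> ^ 2 \<partial>?L) * (\<integral>\<^sup>+ v. ennreal \<bar>g v\<bar> ^ 2 \<partial>?L)"
    by (rule Cauchy_Schwarz_nn_integral) measurable
  also have "(\<integral>\<^sup>+ v. ennreal \<bar>g v\<bar> ^ 2 \<partial>?L) = 1"
    using g nn_integral_eq_integral[of ?L "\<lambda>v. (g v)\<^sup>2"]
    by (simp add: ennreal_power L2_01_def inner01_def power2_eq_square[symmetric])
  finally show ?thesis by (simp add: ennreal_power)
next
  \<comment> \<open>Here \<open>inner01 f g\<close> has the default value 0 of a non-integrable
    integrand, so the bound is trivial.\<close>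
  case False
  then show ?thesis by (simp add: inner01_def not_integrable_integral_eq)
qed

text \<open>Joint measurability of the curve makes the path integrals measurable in
  \<open>w\<close>, and the pathwise Cauchy-Schwarz bound dominates their second moments by that of
  the curve.\<close>

lemma square_integrable_scores:
  fixes b :: "'l::finite \<Rightarrow> real \<Rightarrow> real"
  assumes X: "square_integrable_curve M X" and b: "orthonormal01 b"
  shows "square_integrable_vec M (\<lambda>w. \<chi> k. inner01 (X w) (b k))"
proof -
  let ?L = "lebesgue_on {0..1::real}"
  interpret L: sigma_finite_measure ?L
    by (rule finite_measure.sigma_finite_measure[OF finite_measure_lebesgue_on]) simp
  have [measurable]: "(\<lambda>(w, s). X w s) \<in> borel_measurable (M \<Otimes>\<^sub>M ?L)"
    "b k \<in> borel_measurable ?L" for k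
    using X b by (auto simp: square_integrable_curve_def orthonormal01_def L2_01_def)
  have meas [measurable]: "(\<lambda>w. inner01 (X w) (b k)) \<in> borel_measurable M" for k
    unfolding inner01_def by measurable
  have "integrable M (\<lambda>w. (inner01 (X w) (b k))\<^sup>2)" for k
  proof (rule integrableI_bounded)
    have "(\<integral>\<^sup>+ w. ennreal (norm ((inner01 (X w) (b k))\<^sup>2)) \<partial>M)
        \<le> (\<integral>\<^sup>+ w. (\<integral>\<^sup>+ s. ennreal ((X w s)\<^sup>2) \<partial>?L) \<partial>M)"
    proof (rule nn_integral_mono)
      fix w assume "w \<in> space M"
      then have "X w \<in> borel_measurable ?L" by measurable
      then show "ennreal (norm ((inner01 (X w) (b k))\<^sup>2)) \<le> (\<integral>\<^sup>+ s. ennreal ((X w s)\<^sup>2) \<partial>?L)"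
        using inner01_power2_le[of "X w" "b k"] b by (simp add: orthonormal01_def)
    qed
    then show "(\<integral>\<^sup>+ w. ennreal (norm ((inner01 (X w) (b k))\<^sup>2)) \<partial>M) < \<infinity>"
      using X by (auto simp: square_integrable_curve_def intro: le_less_trans)
  qed measurable
  then show ?thesis using meas by (simp add: square_integrable_vec_iff)
qed

text \<open>A single value of the curve and a function of the noise generate smaller sigma-algebras
  than the two random elements, and independence passes to these.\<close>

lemma (in prob_space) indep_elements_component:
  assumes indep: "indep_elements M (Pi\<^sub>M I (\<lambda>_. borel)) (\<lambda>w. restrict (X w) I) borel U"
    and "r \<in> I" and h: "h \<in> borel_measurable borel"
  shows "indep_var borel (\<lambda>w. X w r :: real) borel (\<lambda>w. h (U w) :: real)"
proof -
  let ?X = "\<lambda>w. restrict (X w) I" and ?S = "Pi\<^sub>M I (\<lambda>_. borel :: real measure)"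
  let ?VX = "vimage_algebra (space M) ?X ?S" and ?VU = "vimage_algebra (space M) U borel"
  have X: "?X \<in> measurable M ?S" and U: "U \<in> measurable M borel"
    and ind: "indep_set (sets ?VX) (sets ?VU)"
    using indep by (auto simp: indep_elements_def)
  \<comment> \<open>Stated for any \<open>N\<close> because it is used for the sigma-algebra
    generated by the curve as well as for \<open>M\<close>.\<close>
  have comp: "(\<lambda>w. X w r) \<in> borel_measurable N" if "?X \<in> measurable N ?S" for N :: "'a measure"
    using measurable_compose[OF that measurable_component_singleton[OF \<open>r \<in> I\<close>]] \<open>r \<in> I\<close> by simp
  have "?X \<in> measurable ?VX ?S" "U \<in> measurable ?VU borel"
    using X U by (auto intro!: measurable_vimage_algebra1 dest: measurable_space)
  then have "(\<lambda>w. X w r) \<in> borel_measurable ?VX" "(\<lambda>w. h (U w)) \<in> borel_measurable ?VU"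
    using comp measurable_compose[OF _ h] by blast+
  then have "sets (vimage_algebra (space M) (\<lambda>w. X w r) borel) \<subseteq> sets ?VX"
    "sets (vimage_algebra (space M) (\<lambda>w. h (U w)) borel) \<subseteq> sets ?VU"
    by (simp_all add: sets_image_in_sets)
  then have "indep_set (sets (vimage_algebra (space M) (\<lambda>w. X w r) borel))
      (sets (vimage_algebra (space M) (\<lambda>w. h (U w)) borel))"
    using ind unfolding indep_sets2_eq by (meson subsetD subset_trans)
  then show ?thesis
    unfolding indep_var_eq sets_vimage_algebra
    using comp[OF X] measurable_compose[OF U h] by blast
qed

text \<open>At each \<open>r\<close> the curve is almost surely a fixed linear functional of the
  scores, so its moments are linear images of theirs. The double sum is nested so that
  \<open>orthonormal01_coefficients\<close> can be applied first in \<open>r\<close> and then in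
  \<open>r'\<close>. The last claim follows from the vanishing covariance of \<open>X w r\<close>
  and \<open>U w\<close> at every \<open>r\<close>.\<close>

lemma (in prob_space) scores_moments:
  fixes X :: "'a \<Rightarrow> real \<Rightarrow> real" and b :: "'l::finite \<Rightarrow> real \<Rightarrow> real"
    and U :: "'a \<Rightarrow> real^'p::finite"
  defines "\<xi> \<equiv> \<lambda>w. \<chi> k::'l. inner01 (X w) (b k)"
  assumes curve: "square_integrable_curve M X" and b: "orthonormal01 b"
    and expansion: "\<forall>r\<in>{0..1}. AE w in M. X w r = (\<Sum>k\<in>UNIV. inner01 (X w) (b k) * b k r)"
    and indep: "indep_elements M (Pi\<^sub>M {0..1} (\<lambda>_. borel)) (\<lambda>w. restrict (X w) {0..1}) borel U"
    and U: "square_integrable_vec M U"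
  shows "r \<in> {0..1} \<Longrightarrow> (\<Sum>k\<in>UNIV. b k r * (LINT w|M. \<xi> w) $ k) = (LINT w|M. X w r)"
    and "r \<in> {0..1} \<Longrightarrow> r' \<in> {0..1} \<Longrightarrow>
      (\<Sum>k\<in>UNIV. (\<Sum>l\<in>UNIV. var_matrix M \<xi> $ k $ l * b l r') * b k r) =
      covariance M (\<lambda>w. X w r) (\<lambda>w. X w r')"
    and "cov_matrix M \<xi> U = 0"
proof -
  have \<xi>: "square_integrable_vec M \<xi>"
    unfolding \<xi>_def by (rule square_integrable_scores[OF curve b])
  \<comment> \<open>The evaluation functional at \<open>r\<close> as a matrix with one row: applied
    to the scores it gives the value of the expansion at \<open>r\<close>.\<close>
  define R :: "real \<Rightarrow> real^'l^1" where "R r = (\<chi> i k. b k r)" for r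
  have R\<xi>: "square_integrable_vec M (\<lambda>w. R r *v \<xi> w)" for r
    by (rule square_integrable_vec_mult[OF \<xi>])
  note R_meas = square_integrable_vecD(3)[OF R\<xi>, where i = 1]
  have X_meas: "(\<lambda>w. X w r) \<in> borel_measurable M" if "r \<in> {0..1}" for r
    \<comment> \<open>The constant function is a placeholder: only the measurability contained in
      \<open>indep_var\<close> is extracted here.\<close>
    using indep_elements_component[OF indep that, of "\<lambda>_. 0"] by (simp add: indep_var_eq)
  have X: "AE w in M. (R r *v \<xi> w) $ 1 = X w r" if "r \<in> {0..1}" for r
    using bspec[OF expansion that] by eventually_elim (simp add: R_def \<xi>_def matrix_vector_mult_def mult.commute)
  show "(\<Sum>k\<in>UNIV. b k r * (LINT w|M. \<xi> w) $ k) = (LINT w|M. X w r)" if r: "r \<in> {0..1}"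
  proof -
    have "(\<Sum>k\<in>UNIV. b k r * (LINT w|M. \<xi> w) $ k) = (R r *v (LINT w|M. \<xi> w)) $ 1"
      by (simp add: R_def matrix_vector_mult_def)
    also have "\<dots> = (LINT w|M. (R r *v \<xi> w) $ 1)"
      by (simp add: integral_matrix_mult[OF \<xi>, symmetric] integral_vec_nth[OF R\<xi>])
    also have "\<dots> = (LINT w|M. X w r)"
      by (rule integral_cong_AE[OF R_meas X_meas[OF r] X[OF r]])
    finally show ?thesis .
  qed
  show "(\<Sum>k\<in>UNIV. (\<Sum>l\<in>UNIV. var_matrix M \<xi> $ k $ l * b l r') * b k r) =
      covariance M (\<lambda>w. X w r) (\<lambda>w. X w r')" if r: "r \<in> {0..1}" "r' \<in> {0..1}"
  proof -
    have "(\<Sum>k\<in>UNIV. (\<Sum>l\<in>UNIV. var_matrix M \<xi> $ k $ l * b l r') * b k r)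
       = (R r ** (var_matrix M \<xi> ** transpose (R r'))) $ 1 $ 1"
      by (simp add: R_def matrix_matrix_mult_def transpose_def mult.commute)
    also have "\<dots> = cov_matrix M (\<lambda>w. R r *v \<xi> w) (\<lambda>w. R r' *v \<xi> w) $ 1 $ 1"
      by (simp add: cov_matrix_mult_left[OF \<xi> R\<xi>] cov_matrix_mult_right[OF \<xi> \<xi>])
    also have "\<dots> = covariance M (\<lambda>w. X w r) (\<lambda>w. X w r')"
      unfolding cov_matrix_def
      by (simp add: covariance_cong_AE[OF X[OF r(1)] X[OF r(2)] R_meas R_meas X_meas[OF r(1)] X_meas[OF r(2)]])
    finally show ?thesis .
  qed
  \<comment> \<open>For fixed \<open>j\<close>, column \<open>j\<close> is the coefficient vector of
    a combination of the \<open>b k\<close> which at each \<open>r\<close> equals the covariance of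
    \<open>X w r\<close> with \<open>U w $ j\<close>, and this is 0 by independence.\<close>
  have "cov_matrix M \<xi> U $ k $ j = 0" for k j
  proof (rule orthonormal01_coefficients[OF b])
    fix r :: real assume r: "r \<in> {0..1}"
    have Uj: "(\<lambda>w. U w $ j) \<in> borel_measurable M" "integrable M (\<lambda>w. U w $ j)"
      using square_integrable_vecD[OF U] by blast+
    have intX: "integrable M (\<lambda>w. X w r)"
      using square_integrable_vecD(4)[OF R\<xi>, of r 1] integrable_cong_AE[OF R_meas X_meas[OF r] X[OF r]] by simp
    have "(\<Sum>k\<in>UNIV. cov_matrix M \<xi> U $ k $ j * b k r) = (R r ** cov_matrix M \<xi> U) $ 1 $ j"
      by (simp add: R_def matrix_matrix_mult_def mult.commute)
    also have "\<dots> = cov_matrix M (\<lambda>w. R r *v \<xi> w) U $ 1 $ j"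
      by (simp add: cov_matrix_mult_left[OF \<xi> U])
    also have "\<dots> = (LINT w|M. (R r *v \<xi> w) $ 1 * U w $ j) - (LINT w|M. (R r *v \<xi> w) $ 1) * (LINT w|M. U w $ j)"
      by (rule cov_matrix_nth[OF R\<xi> U])
    also have "(LINT w|M. (R r *v \<xi> w) $ 1) = (LINT w|M. X w r)"
      by (rule integral_cong_AE[OF R_meas X_meas[OF r] X[OF r]])
    also have "(LINT w|M. (R r *v \<xi> w) $ 1 * U w $ j) = (LINT w|M. X w r * U w $ j)"
      using R_meas X_meas[OF r] X[OF r] Uj
      by (intro integral_cong_AE borel_measurable_times) auto
    also have "\<dots> = (LINT w|M. X w r) * (LINT w|M. U w $ j)"
      by (rule indep_var_lebesgue_integral[OF indep_elements_component[OF indep r, of "\<lambda>u. u $ j"] intX Uj(2)])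
        simp
    finally show "(\<Sum>k\<in>UNIV. cov_matrix M \<xi> U $ k $ j * b k r) = 0" by simp
  qed
  then show "cov_matrix M \<xi> U = 0" by (simp add: vec_eq_iff)
qed

section \<open>Time invariance of the score variance, and the factor model on the enlarged space and
  on \<open>M\<close>\<close>

theorem proposition2p1:
  fixes M :: "'a measure"
    and X :: "nat \<Rightarrow> 'a \<Rightarrow> real \<Rightarrow> real"
    and \<mu> :: "real \<Rightarrow> real"
    and \<Gamma> :: "real \<Rightarrow> real \<Rightarrow> real"
    and b :: "'l::finite \<Rightarrow> real \<Rightarrow> real"
    and s :: "'p::{finite,linorder} \<Rightarrow> real"
    and U Y :: "nat \<Rightarrow> 'a \<Rightarrow> (real, 'p::{finite,linorder}) vec"
  assumes "prob_space M"
    and curves: "\<And>t. t \<ge> 1 \<Longrightarrow> square_integrable_curve M (X t)"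
    and stationary: "stationary M X"
    and mean: "\<And>t r. t \<ge> 1 \<Longrightarrow> r \<in> {0..1} \<Longrightarrow> \<mu> r = (LINT w|M. X t w r)"
    and kernel: "\<And>t r r'. t \<ge> 1 \<Longrightarrow> r \<in> {0..1} \<Longrightarrow> r' \<in> {0..1} \<Longrightarrow>
        \<Gamma> r r' = covariance M (\<lambda>w. X t w r) (\<lambda>w. X t w r')"
    and orthonormal: "orthonormal01 b"
    and expansion: "\<And>t r. t \<ge> 1 \<Longrightarrow> r \<in> {0..1} \<Longrightarrow>
        AE w in M. X t w r = (\<Sum>k\<in>UNIV. inner01 (X t w) (b k) * b k r)"
    and points: "strict_mono s" "range s \<subseteq> {0..1}"
    and observations: "\<And>t w. t \<ge> 1 \<Longrightarrow> w \<in> space M \<Longrightarrow> Y t w = (\<chi> i. X t w (s i)) + U t w"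
    and indep: "\<And>t. t \<ge> 1 \<Longrightarrow>
        indep_elements M (Pi\<^sub>M {0..1} (\<lambda>_. borel)) (\<lambda>w. restrict (X t w) {0..1}) borel (U t)"
    and noise: "\<And>t. t \<ge> 1 \<Longrightarrow> square_integrable_vec M (U t)"
      "\<And>t. t \<ge> 1 \<Longrightarrow> (LINT w|M. U t w) = 0"
      "\<And>t. t \<ge> 1 \<Longrightarrow> diagonal (var_matrix M (U t))"
  shows "(\<exists>K :: real measure. prob_space K \<and>
            follows_factor_model TYPE('l) (M \<Otimes>\<^sub>M K) (\<chi> i. \<mu> (s i))
              (\<lambda>t. U t \<circ> fst) (\<lambda>t. Y t \<circ> fst)) \<and>
         ((\<forall>t\<ge>1. invertible (var_matrix M (\<lambda>w. \<chi> k::'l. inner01 (X t w) (b k)))) \<longrightarrow>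
            follows_factor_model TYPE('l) M (\<chi> i. \<mu> (s i)) U Y)"
proof -
  interpret prob_space M by fact
  define \<xi> where "\<xi> t w = (\<chi> k::'l. inner01 (X t w) (b k))" for t w
  define A :: "real^'l^'p::{finite,linorder}" where "A = (\<chi> i k. b k (s i))"
  have s: "s i \<in> {0..1}" for i using points(2) by blast
  have expansion_all: "\<forall>r\<in>{0..1}. AE w in M. X t w r = (\<Sum>k\<in>UNIV. inner01 (X t w) (b k) * b k r)"
    if "t \<ge> 1" for t
    using expansion[OF that] by blast
  have \<xi>: "square_integrable_vec M (\<xi> t)" if "t \<ge> 1" for t
    unfolding \<xi>_def by (rule square_integrable_scores[OF curves[OF that] orthonormal])
  have cov\<xi>U: "cov_matrix M (\<xi> t) (U t) = 0" if "t \<ge> 1" for t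
    using scores_moments(3)[OF curves[OF that] orthonormal expansion_all[OF that] indep[OF that] noise(1)[OF that], folded \<xi>_def] by simp
  have mean\<xi>: "A *v (LINT w|M. \<xi> t w) = (\<chi> i. \<mu> (s i))" if "t \<ge> 1" for t
    using scores_moments(1)[OF curves[OF that] orthonormal expansion_all[OF that] indep[OF that] noise(1)[OF that], folded \<xi>_def, OF s] mean[OF that s]
    by (simp add: vec_eq_iff A_def matrix_vector_mult_def)
  \<comment> \<open>The variances at times \<open>t\<close> and 1 yield the same kernel
    \<open>\<Gamma>\<close>. Linear independence in \<open>r\<close>, with \<open>r'\<close> fixed,
    removes the outer sum; linear independence in \<open>r'\<close> then removes the inner
    one.\<close>
  have var\<xi>: "var_matrix M (\<xi> t) = var_matrix M (\<xi> 1)" if t: "t \<ge> 1" for t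
  proof -
    let ?V = "\<lambda>t. var_matrix M (\<xi> t)"
    have "?V t $ k $ l - ?V 1 $ k $ l = 0" for k l
    proof (rule orthonormal01_coefficients[OF orthonormal])
      fix r' :: real assume r': "r' \<in> {0..1}"
      have "(\<Sum>l\<in>UNIV. ?V t $ k $ l * b l r') - (\<Sum>l\<in>UNIV. ?V 1 $ k $ l * b l r') = 0" for k
      proof (rule orthonormal01_coefficients[OF orthonormal])
        fix r :: real assume r: "r \<in> {0..1}"
        have "(\<Sum>k\<in>UNIV. (\<Sum>l\<in>UNIV. ?V t $ k $ l * b l r') * b k r) = \<Gamma> r r'" if "t \<ge> 1" for t
          using scores_moments(2)[OF curves[OF that] orthonormal expansion_all[OF that] indep[OF that] noise(1)[OF that], folded \<xi>_def, OF r r'] kernel[OF that r r'] by simp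
        from this[OF t] this[of 1]
        show "(\<Sum>k\<in>UNIV. ((\<Sum>l\<in>UNIV. ?V t $ k $ l * b l r') -
            (\<Sum>l\<in>UNIV. ?V 1 $ k $ l * b l r')) * b k r) = 0"
          by (simp add: left_diff_distrib sum_subtractf)
      qed
      then show "(\<Sum>l\<in>UNIV. (?V t $ k $ l - ?V 1 $ k $ l) * b l r') = 0"
        by (simp add: left_diff_distrib sum_subtractf)
    qed
    then show ?thesis by (simp add: vec_eq_iff)
  qed
  have Y: "AE w in M. Y t w = A *v \<xi> t w + U t w" if t: "t \<ge> 1" for t
  proof -
    \<comment> \<open>The exceptional null set of the expansion may depend on the point; finitely
      many observation points admit a common one.\<close>
    have "AE w in M. \<forall>i. X t w (s i) = (\<Sum>k\<in>UNIV. inner01 (X t w) (b k) * b k (s i))"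
      using expansion[OF t s] by (simp add: AE_all_countable)
    with AE_space show ?thesis
      by eventually_elim
        (simp add: observations[OF t] vec_eq_iff A_def \<xi>_def matrix_vector_mult_def mult.commute)
  qed
  \<comment> \<open>Chosen from the variance at time 1; by \<open>var\<xi>\<close> the same
    \<open>P\<close> and \<open>I\<close> work at all times.\<close>
  obtain P :: "real^'l^'l" and I where P: "invertible P"
    and PI: "P ** var_matrix M (\<xi> 1) ** transpose P = indicator_matrix I"
    using psd_matrix_congruent_indicator[OF transpose_cov_matrix psd_var_matrix[OF \<xi>[of 1]]] by auto
  have P\<xi>: "P ** var_matrix M (\<xi> t) ** transpose P = indicator_matrix I" if "t \<ge> 1" for t
    using var\<xi>[OF that] PI by simp
  show ?thesis
  proof (intro conjI impI)
    obtain K :: "real measure" and Z :: "real \<Rightarrow> real^'l" where K: "prob_space K"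
      and Z: "square_integrable_vec K Z" "(LINT w|K. Z w) = 0" "var_matrix K Z = mat 1"
      using exists_standardized_vector by blast
    interpret K: prob_space K by fact
    interpret MK: pair_prob_space M K ..
    let ?N = "M \<Otimes>\<^sub>M K"
    have fst: "fst \<in> measurable ?N M" "distr ?N M fst = M"
      by (simp_all add: K.distr_pair_fst)
    have snd: "snd \<in> measurable ?N K" "distr ?N K snd = K"
      by (simp_all add: distr_pair_snd K.sigma_finite_measure_axioms)
    \<comment> \<open>Projecting a standardized vector gives the variance required of
      \<open>Z\<close> in \<open>follows_factor_modelI\<close>. A single \<open>W\<close> serves all
      \<open>t\<close>, since the model imposes conditions at each time separately and none across
      times.\<close>
    define W where "W w = indicator_matrix (- I) *v Z w" for w
    have W: "square_integrable_vec K W"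
      unfolding W_def by (rule K.square_integrable_vec_mult[OF Z(1)])
    have EW: "(LINT w|K. W w) = 0"
      unfolding W_def by (simp add: K.integral_matrix_mult[OF Z(1)] Z(2))
    have varW: "var_matrix K W = indicator_matrix (- I)"
      unfolding W_def
      by (simp add: K.cov_matrix_mult_left[OF Z(1) K.square_integrable_vec_mult[OF Z(1)]]
          K.cov_matrix_mult_right[OF Z(1) Z(1)] Z(3) indicator_matrix_mult)
    note sq_fst = square_integrable_vec_measure_preserving[OF fst]
    note cov_fst = cov_matrix_measure_preserving[OF fst]
    note int_fst = integral_measure_preserving[OF fst square_integrable_vecD(1)]
    have "follows_factor_model TYPE('l) ?N (\<chi> i. \<mu> (s i)) (\<lambda>t w. U t (fst w)) (\<lambda>t w. Y t (fst w))"
    proof (rule MK.P.follows_factor_modelI[where A = A and P = P and I = I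
          and \<xi> = "\<lambda>t w. \<xi> t (fst w)" and Z = "\<lambda>t w. W (snd w)"])
      show "square_integrable_vec ?N (\<lambda>w. W (snd w))"
        by (rule square_integrable_vec_measure_preserving[OF snd W])
      show "(LINT w|?N. W (snd w)) = 0"
        using integral_measure_preserving[OF snd K.square_integrable_vecD(1)[OF W]] EW by simp
      show "var_matrix ?N (\<lambda>w. W (snd w)) = indicator_matrix (- I)"
        using cov_matrix_measure_preserving[OF snd W W] varW by simp
    next
      fix t :: nat assume t: "t \<ge> 1"
      note \<xi>t = \<xi>[OF t] and Ut = noise(1)[OF t]
      show "square_integrable_vec ?N (\<lambda>w. \<xi> t (fst w))" "square_integrable_vec ?N (\<lambda>w. U t (fst w))"
        by (rule sq_fst[OF \<xi>t], rule sq_fst[OF Ut])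
      show "P ** var_matrix ?N (\<lambda>w. \<xi> t (fst w)) ** transpose P = indicator_matrix I"
        "cov_matrix ?N (\<lambda>w. \<xi> t (fst w)) (\<lambda>w. U t (fst w)) = 0"
        "diagonal (var_matrix ?N (\<lambda>w. U t (fst w)))"
        by (simp_all only: cov_fst[OF \<xi>t \<xi>t] cov_fst[OF \<xi>t Ut] cov_fst[OF Ut Ut]
            P\<xi>[OF t] cov\<xi>U[OF t] noise(3)[OF t])
      show "A *v (LINT w|?N. \<xi> t (fst w)) = (\<chi> i. \<mu> (s i))" "(LINT w|?N. U t (fst w)) = 0"
        by (simp_all only: int_fst[OF \<xi>t] int_fst[OF Ut] mean\<xi>[OF t] noise(2)[OF t])
      show "AE w in ?N. Y t (fst w) = A *v \<xi> t (fst w) + U t (fst w)"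
        by (rule AE_measure_preserving[OF fst Y[OF t]])
      show "cov_matrix ?N (\<lambda>w. W (snd w)) (\<lambda>w. \<xi> t (fst w)) = 0"
        "cov_matrix ?N (\<lambda>w. W (snd w)) (\<lambda>w. U t (fst w)) = 0"
        by (rule cov_matrix_pair_eq_0[OF prob_space_axioms K \<xi>t W],
            rule cov_matrix_pair_eq_0[OF prob_space_axioms K Ut W])
    qed (rule P)
    then show "\<exists>K :: real measure. prob_space K \<and>
        follows_factor_model TYPE('l) (M \<Otimes>\<^sub>M K) (\<chi> i. \<mu> (s i)) (\<lambda>t. U t \<circ> fst) (\<lambda>t. Y t \<circ> fst)"
      using K by (auto simp: comp_def)
  next
    assume inv: "\<forall>t\<ge>1. invertible (var_matrix M (\<lambda>w. \<chi> k::'l. inner01 (X t w) (b k)))"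
    moreover have "\<xi> 1 = (\<lambda>w. \<chi> k. inner01 (X 1 w) (b k))"
      by (simp add: \<xi>_def fun_eq_iff)
    ultimately have "invertible (var_matrix M (\<xi> 1))"
      by simp
    \<comment> \<open>By \<open>PI\<close> this matrix is a product of three invertible ones. Hence
      \<open>- I\<close> is empty, the auxiliary vector must have variance 0, and the constant 0 on
      \<open>M\<close> will do.\<close>
    then have "invertible (indicator_matrix I :: real^'l^'l)"
      using P unfolding PI[symmetric] by (intro invertible_mult transpose_invertible)
    then have I: "I = UNIV" by (rule invertible_indicator_matrix)
    show "follows_factor_model TYPE('l) M (\<chi> i. \<mu> (s i)) U Y"
    proof (rule follows_factor_modelI[OF P \<xi> P\<xi> cov\<xi>U mean\<xi> noise Y, where Z = "\<lambda>t w. 0"])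
      show "var_matrix M (\<lambda>w. 0) = (indicator_matrix (- I) :: real^'l^'l)"
        by (simp add: I indicator_matrix_empty cov_matrix_def covariance_def vec_eq_iff)
    qed (simp_all add: square_integrable_vec_const cov_matrix_def covariance_def vec_eq_iff)
  qed
qed

end
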